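(* Let $\gamma_P:\mathbb{R}^n\to\mathbb{R}$ be concave and $\rho_P:\mathbb{R}^n\to\mathbb{R}$ be convex, both continuously differentiable with Lipschitz continuous gradients, let $(\rho_P^{\text{ref}},\gamma_P^{\text{ref}})\in\mathbb{R}^2$, and let $\Delta$, $X$, $A$ and $L$ be as defined in the context. Let $\tau\in(0,2/L)$, let $x^0\in X$ with $A(x^0)>0$, and let $(x^\nu)$ be the sequence generated from $x^0$ by the modified projected gradient algorithm described in the context. Then each iterate $x^\nu\in\Delta$ satisfies $x^\nu\in X$ and $A(x^\nu)>0$, and each limit point of the sequence $(x^\nu)$ is a global solution of the problem of maximizing $A(x)$ over $x\in X$ and, in turn, a global Pareto optimum of the two-objective problem of simultaneously maximizing $\gamma_P(x)$ and minimizing $\rho_P(x)$ over $x\in\Delta$.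
   Context: $\Delta=\{x\in\mathbb{R}^n : x\ge 0,\ \sum_{i=1}^n x_i=1\}$ is the unit simplex and $P_\Delta$ denotes Euclidean projection onto $\Delta$. $X=\{x\in\Delta : \gamma_P(x)\ge\gamma_P^{\text{ref}},\ \rho_P(x)\le\rho_P^{\text{ref}}\}$ and $A(x)=\big(\gamma_P(x)-\gamma_P^{\text{ref}}\big)\big(\rho_P^{\text{ref}}-\rho_P(x)\big)$. Constant $L$: let $L_{\nabla\gamma_P}$, $L_{\nabla\rho_P}$, $L_{\gamma_P}$, $L_{\rho_P}$ be Lipschitz moduli on $X$ (Euclidean norm) of $\nabla\gamma_P$, $\nabla\rho_P$, $\gamma_P$, $\rho_P$, respectively; let $\rho_P^{\min}=\min\{\rho_P(x):x\in X\}$ and $\gamma_P^{\max}=\max\{\gamma_P(x):x\in X\}$. Then $$L= L_{\nabla\gamma_P}\,(\rho_P^{\text{ref}}-\rho_P^{\min})+L_{\nabla\rho_P}\,(\gamma_P^{\max}-\gamma_P^{\text{ref}})+2L_{\rho_P}L_{\gamma_P}.$$ Algorithm: given $\tau\in(0,2/L)$ and $x^0\in X$ with $A(x^0)>0$, for $\nu=0,1,2,\dots$: if $x^\nu$ is stationary, i.e. $-\nabla A(x^\nu)^{T}(x-x^\nu)\ge 0$ for all $x\in X$, stop and return $x^\nu$; otherwise set $x^{\nu+1}=P_\Delta\big(x^\nu+\tau\nabla A(x^\nu)\big)$. A point $\bar x\in\Delta$ is a global Pareto optimum of the two-objective problem if there is no $x\in\Delta$ with $\gamma_P(x)\ge\gamma_P(\bar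 x)$ and $\rho_P(x)\le\rho_P(\bar x)$, with at least one of these two inequalities strict. *)

theory Defs
  imports "HOL-Analysis.Analysis"
begin

definition gradient :: "('a::real_inner \<Rightarrow> real) \<Rightarrow> 'a \<Rightarrow> 'a"
  where "gradient f x = (THE D. GDERIV f x :> D)"

lemma gradient_eqI: "GDERIV f x :> D \<Longrightarrow> gradient f x = D"
  unfolding gradient_def
proof (rule the_equality)
  fix E assume "GDERIV f x :> D" "GDERIV f x :> E"
  then have "(\<lambda>h. h \<bullet> E) = (\<lambda>h. h \<bullet> D)"
    unfolding gderiv_def by (rule has_derivative_unique[rotated])
  then have "\<forall>h. h \<bullet> E = h \<bullet> D" by metis
  then show "E = D" by (simp add: vector_eq_ldot)
qed

lemma GDERIV_gradient:
  fixes f :: "'a::euclidean_space \<Rightarrow> real"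
  assumes "f differentiable (at x)"
  shows "GDERIV f x :> gradient f x"
proof -
  obtain f' where f': "(f has_derivative f') (at x)"
    using assms by (auto simp: differentiable_def)
  interpret bounded_linear f' using f' by (rule has_derivative_bounded_linear)
  have "f' = (\<lambda>h. h \<bullet> adjoint f' 1)"
    using adjoint_works[OF linear_axioms, of _ 1] by auto
  with f' have "GDERIV f x :> adjoint f' 1"
    by (simp add: gderiv_def)
  then show ?thesis using gradient_eqI by metis
qed

definition C1 :: "('a::euclidean_space \<Rightarrow> real) \<Rightarrow> bool"
  where "C1 f \<longleftrightarrow> (\<forall>x. f differentiable (at x)) \<and> continuous_on UNIV (gradient f)"

definition unit_simplex :: "(real^'n) set"
  where "unit_simplex = {x. (\<forall>i. 0 \<le> x $ i) \<and> (\<Sum>i\<in>UNIV. x $ i) = 1}"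

definition feasible ::
  "(real^'n \<Rightarrow> real) \<Rightarrow> (real^'n \<Rightarrow> real) \<Rightarrow> real \<Rightarrow> real \<Rightarrow> (real^'n) set"
  where "feasible \<gamma> \<rho> \<gamma>ref \<rho>ref = {x \<in> unit_simplex. \<gamma> x \<ge> \<gamma>ref \<and> \<rho> x \<le> \<rho>ref}"

definition area ::
  "(real^'n \<Rightarrow> real) \<Rightarrow> (real^'n \<Rightarrow> real) \<Rightarrow> real \<Rightarrow> real \<Rightarrow> real^'n \<Rightarrow> real"
  where "area \<gamma> \<rho> \<gamma>ref \<rho>ref x = (\<gamma> x - \<gamma>ref) * (\<rho>ref - \<rho> x)"

text \<open>The first four arguments are Lipschitz constants on the feasible set of the gradient of
  \<open>\<gamma>\<close>, the gradient of \<open>\<rho>\<close>, \<open>\<gamma>\<close> and \<open>\<rho>\<close>. For continuous \<open>\<gamma>\<close> and \<open>\<rho>\<close> and a nonempty feasible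
  set, compactness makes the infimum and supremum a minimum and a maximum.
  A step size in the open interval from 0 to \<open>2 / L\<close> is written \<open>0 < \<tau>\<close> and \<open>\<tau> * L < 2\<close>, so that
  \<open>L = 0\<close> (where \<open>2 / L\<close> means infinity) puts no upper bound on \<open>\<tau>\<close>.\<close>

definition area_lipschitz ::
  "real \<Rightarrow> real \<Rightarrow> real \<Rightarrow> real \<Rightarrow>
   (real^'n \<Rightarrow> real) \<Rightarrow> (real^'n \<Rightarrow> real) \<Rightarrow> real \<Rightarrow> real \<Rightarrow> real"
  where "area_lipschitz Ld\<gamma> Ld\<rho> L\<gamma> L\<rho> \<gamma> \<rho> \<gamma>ref \<rho>ref =
    Ld\<gamma> * (\<rho>ref - (INF x\<in>feasible \<gamma> \<rho> \<gamma>ref \<rho>ref. \<rho> x))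
    + Ld\<rho> * ((SUP x\<in>feasible \<gamma> \<rho> \<gamma>ref \<rho>ref. \<gamma> x) - \<gamma>ref)
    + 2 * L\<rho> * L\<gamma>"

text \<open>Stationarity for maximizing \<open>f\<close> over \<open>S\<close>.\<close>

definition stationary :: "('a::real_inner \<Rightarrow> real) \<Rightarrow> 'a set \<Rightarrow> 'a \<Rightarrow> bool"
  where "stationary f S x \<longleftrightarrow> (\<forall>y\<in>S. - gradient f x \<bullet> (y - x) \<ge> 0)"

text \<open>Modified projected gradient method: stationarity is tested with respect to \<open>X\<close>, but the
  projection is onto the simplex. If the method stops, the returned point is repeated forever,
  so that it is the only limit point of the resulting sequence.\<close>

primrec iterate ::
  "(real^'n \<Rightarrow> real) \<Rightarrow> (real^'n) set \<Rightarrow> real \<Rightarrow> real^'n \<Rightarrow> nat \<Rightarrow> real^'n"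
  where
    "iterate f X \<tau> x0 0 = x0"
  | "iterate f X \<tau> x0 (Suc k) =
      (let x = iterate f X \<tau> x0 k in
       if stationary f X x then x
       else closest_point unit_simplex (x + \<tau> *\<^sub>R gradient f x))"

definition limit_point :: "(nat \<Rightarrow> 'a::topological_space) \<Rightarrow> 'a \<Rightarrow> bool"
  where "limit_point u l \<longleftrightarrow> (\<exists>r. strict_mono r \<and> (u \<circ> r) \<longlonglongrightarrow> l)"

definition pareto_optimal ::
  "('a \<Rightarrow> real) \<Rightarrow> ('a \<Rightarrow> real) \<Rightarrow> 'a set \<Rightarrow> 'a \<Rightarrow> bool"
  where "pareto_optimal \<gamma> \<rho> S z \<longleftrightarrow> z \<in> S \<and>
    \<not> (\<exists>x\<in>S. \<gamma> x \<ge> \<gamma> z \<and> \<rho> x \<le> \<rho> z \<and> (\<gamma> x > \<gamma> z \<or> \<rho> x < \<rho> z))"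

end

theory Submission
  imports Defs
begin

text \<open>
  Write \<open>g = \<gamma> - \<gamma>ref\<close> and \<open>r = \<rho>ref - \<rho>\<close>. Both are concave, \<open>A = g * r\<close>, and \<open>X\<close> is the convex
  compact part of the simplex on which \<open>g\<close> and \<open>r\<close> are nonnegative.

  The method projects onto the simplex only, so the first point is that a step from \<open>x \<in> X\<close> with
  \<open>A x > 0\<close> to its projection \<open>y\<close> cannot leave \<open>X\<close>. As long as the segment from \<open>x\<close> towards \<open>y\<close>
  runs inside \<open>X\<close>, the usual descent lemma bounds \<open>A\<close> below by a quadratic with curvature
  \<open>L\<close>; together with the obtuse-angle property of the projection and \<open>\<tau> * L < 2\<close> this gives
  \<open>A \<ge> A x > 0\<close> there (\<open>area_ge_along_step\<close>). But \<open>X\<close> can be left within the simplex only through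
  a point where \<open>g\<close> or \<open>r\<close> vanishes, that is, where \<open>A = 0\<close>. Hence the segment never leaves \<open>X\<close>
  (\<open>projected_step\<close>), and the step increases \<open>A\<close> by at least a fixed positive multiple of
  \<open>(norm (y - x))\<^sup>2\<close>.

  Since \<open>A\<close> is bounded on \<open>X\<close>, these increments tend to 0, and so do the steps. The obtuse-angle
  inequality then passes to the limit and shows that every limit point is stationary, with
  positive \<open>A\<close>. Although \<open>A\<close> need not be concave, stationary points with \<open>A > 0\<close> are global maximizers:
  by the gradient inequalities for \<open>g\<close> and \<open>r\<close>, stationarity of \<open>z\<close> gives
  \<open>r z * g y + g z * r y \<le> 2 * A z\<close>, and the left-hand side is at least
  \<open>2 * sqrt (A z * A y)\<close> by the inequality of the arithmetic and geometric mean
  (\<open>stationary_imp_arg_max\<close>). A point that dominates a maximizer with \<open>A > 0\<close> would be feasible and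
  would have larger \<open>A\<close>, so maximizers are Pareto optimal.

  The constant \<open>L\<close> bounds the variation of the gradient of \<open>A\<close> only in directions \<open>y - x\<close> with
  \<open>x, y \<in> X\<close>: a Lipschitz constant of \<open>\<gamma>\<close> on \<open>X\<close> says nothing about the component of the gradient
  of \<open>\<gamma>\<close> orthogonal to the simplex. These directions are all that the argument uses.
\<close>

section \<open>Gradients along segments\<close>

lemma has_real_derivative_along_line:
  fixes f :: "'a::real_inner \<Rightarrow> real"
  assumes "GDERIV f (x + t *\<^sub>R d) :> D"
  shows "((\<lambda>s. f (x + s *\<^sub>R d)) has_real_derivative D \<bullet> d) (at t)"
proof -
  have "((\<lambda>s. x + s *\<^sub>R d) has_derivative (\<lambda>s. s *\<^sub>R d)) (at t)"
    by (auto intro!: derivative_eq_intros)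
  from has_derivative_compose[OF this assms[unfolded gderiv_def]] show ?thesis
    by (simp add: has_field_derivative_def inner_commute mult_commute_abs)
qed

lemma tendsto_difference_quotient:
  fixes f :: "'a::real_inner \<Rightarrow> real"
  assumes "GDERIV f x :> D"
  shows "((\<lambda>t. (f (x + t *\<^sub>R d) - f x) / t) \<longlongrightarrow> D \<bullet> d) (at_right 0)"
proof -
  have "((\<lambda>s. f (x + s *\<^sub>R d)) has_real_derivative D \<bullet> d) (at 0)"
    using assms by (intro has_real_derivative_along_line) simp
  then have "((\<lambda>t. (f (x + t *\<^sub>R d) - f x) / t) \<longlongrightarrow> D \<bullet> d) (at 0)"
    by (simp add: DERIV_def)
  then show ?thesis
    by (rule tendsto_within_subset) simp
qed

lemma convex_segment_point:
  fixes x y :: "'a::real_vector"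
  assumes "convex S" "x \<in> S" "y \<in> S" "0 \<le> t" "t \<le> 1"
  shows "x + t *\<^sub>R (y - x) \<in> S"
proof -
  have "(1 - t) *\<^sub>R x + t *\<^sub>R y \<in> S"
    using assms by (intro convexD) auto
  then show ?thesis by (simp add: algebra_simps)
qed

lemma lipschitz_on_imp_gradient_bound:
  fixes f :: "'a::real_inner \<Rightarrow> real"
  assumes lip: "K-lipschitz_on S f" and "convex S" "x \<in> S" "y \<in> S" and D: "GDERIV f x :> D"
  shows "\<bar>D \<bullet> (y - x)\<bar> \<le> K * norm (y - x)"
proof -
  have "((\<lambda>t. \<bar>(f (x + t *\<^sub>R (y - x)) - f x) / t\<bar>) \<longlongrightarrow> \<bar>D \<bullet> (y - x)\<bar>) (at_right 0)"
    by (intro tendsto_rabs tendsto_difference_quotient D)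
  moreover have "\<forall>\<^sub>F t in at_right 0. \<bar>(f (x + t *\<^sub>R (y - x)) - f x) / t\<bar> \<le> K * norm (y - x)"
    using eventually_at_right_real[OF zero_less_one]
  proof eventually_elim
    case (elim t)
    then have "x + t *\<^sub>R (y - x) \<in> S"
      using assms by (intro convex_segment_point) auto
    from lipschitz_on_normD[OF lip this \<open>x \<in> S\<close>] elim show ?case
      by (simp add: divide_le_eq abs_divide mult_ac)
  qed
  ultimately show ?thesis
    by (rule tendsto_upperbound) simp
qed

lemma convex_on_gradient_inequality:
  fixes f :: "'a::real_inner \<Rightarrow> real"
  assumes "convex_on S f" "x \<in> S" "y \<in> S" and D: "GDERIV f x :> D"
  shows "D \<bullet> (y - x) \<le> f y - f x"
proof -
  have "\<forall>\<^sub>F t in at_right 0. (f (x + t *\<^sub>R (y - x)) - f x) / t \<le> f y - f x"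
    using eventually_at_right_real[OF zero_less_one]
  proof eventually_elim
    case (elim t)
    then have "f ((1 - t) *\<^sub>R x + t *\<^sub>R y) \<le> (1 - t) * f x + t * f y"
      using assms by (intro convex_onD[OF assms(1)]) auto
    then have "f (x + t *\<^sub>R (y - x)) - f x \<le> (f y - f x) * t"
      by (simp add: algebra_simps)
    with elim show ?case by (simp add: divide_le_eq)
  qed
  with tendsto_difference_quotient[OF D] show ?thesis
    by (rule tendsto_upperbound) simp
qed

text \<open>The descent lemma, with the Lipschitz condition on the gradient \<open>G\<close> stated for its component
  along the segment, which is the one that Lipschitz constants on a lower-dimensional set control.
  The function \<open>\<psi>\<close> of the proof is \<open>f\<close> along the segment minus the claimed lower bound, up to a
  constant.\<close>

lemma quadratic_lower_bound:
  fixes f :: "'a::real_inner \<Rightarrow> real"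
  assumes D: "\<And>u. GDERIV f u :> G u"
    and G: "\<And>t. 0 \<le> t \<Longrightarrow> t \<le> 1 \<Longrightarrow> (G (x + t *\<^sub>R d) - G x) \<bullet> d \<ge> - K * t * (norm d)\<^sup>2"
  shows "f (x + d) \<ge> f x + G x \<bullet> d - K / 2 * (norm d)\<^sup>2"
proof -
  define \<psi> where "\<psi> t = f (x + t *\<^sub>R d) - t * (G x \<bullet> d) + K / 2 * t\<^sup>2 * (norm d)\<^sup>2" for t
  have "\<psi> 0 \<le> \<psi> 1"
  proof (rule DERIV_nonneg_imp_nondecreasing[where f = \<psi>])
    fix t :: real assume t: "0 \<le> t" "t \<le> 1"
    have "(\<psi> has_real_derivative G (x + t *\<^sub>R d) \<bullet> d - G x \<bullet> d + K * t * (norm d)\<^sup>2) (at t)"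
      unfolding \<psi>_def
      by (auto intro!: derivative_eq_intros has_real_derivative_along_line[OF D])
    moreover have "G (x + t *\<^sub>R d) \<bullet> d - G x \<bullet> d + K * t * (norm d)\<^sup>2 \<ge> 0"
      using G[OF t] by (simp add: inner_diff_left)
    ultimately show "\<exists>D. (\<psi> has_real_derivative D) (at t) \<and> 0 \<le> D" by blast
  qed simp
  then show ?thesis by (simp add: \<psi>_def)
qed

section \<open>The unit simplex\<close>

lemma convex_unit_simplex: "convex (unit_simplex :: (real^'n) set)"
  unfolding unit_simplex_def convex_def
  by (auto simp: sum.distrib simp flip: sum_distrib_left)

lemma compact_unit_simplex: "compact (unit_simplex :: (real^'n) set)"
proof -
  have "norm x \<le> 1" if "x \<in> unit_simplex" for x :: "real^'n"
    using norm_le_l1_cart[of x] that by (simp add: unit_simplex_def)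
  then have "bounded (unit_simplex :: (real^'n) set)"
    by (rule boundedI)
  moreover have "closed {x :: real^'n. (\<forall>i. 0 \<le> x $ i) \<and> (\<Sum>i\<in>UNIV. x $ i) = 1}"
    by (intro closed_Collect_conj closed_Collect_all closed_Collect_le closed_Collect_eq
        continuous_intros)
  ultimately show ?thesis
    by (simp add: compact_eq_bounded_closed unit_simplex_def)
qed

section \<open>The area function of a concave and a convex criterion\<close>

locale concave_convex_criteria =
  fixes \<gamma> \<rho> :: "real^'n \<Rightarrow> real" and \<gamma>ref \<rho>ref :: real
  assumes concave: "concave_on UNIV \<gamma>" and convex: "convex_on UNIV \<rho>"
    and C1_\<gamma>: "C1 \<gamma>" and C1_\<rho>: "C1 \<rho>"
begin

abbreviation "X \<equiv> feasible \<gamma> \<rho> \<gamma>ref \<rho>ref"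
abbreviation "A \<equiv> area \<gamma> \<rho> \<gamma>ref \<rho>ref"

lemma GDERIV_\<gamma>: "GDERIV \<gamma> x :> gradient \<gamma> x" and GDERIV_\<rho>: "GDERIV \<rho> x :> gradient \<rho> x"
  using C1_\<gamma> C1_\<rho> by (auto simp: C1_def intro!: GDERIV_gradient)

lemma continuous_on_\<gamma> [continuous_intros]: "continuous_on S \<gamma>"
  and continuous_on_\<rho> [continuous_intros]: "continuous_on S \<rho>"
  using C1_\<gamma> C1_\<rho> unfolding C1_def
  by (blast intro: continuous_at_imp_continuous_on differentiable_imp_continuous_within)+

lemma continuous_on_area: "continuous_on S A"
  unfolding area_def by (intro continuous_intros)

lemma GDERIV_area:
  "GDERIV A x :> (\<rho>ref - \<rho> x) *\<^sub>R gradient \<gamma> x - (\<gamma> x - \<gamma>ref) *\<^sub>R gradient \<rho> x"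
  unfolding area_def
  by (rule GDERIV_subst[OF GDERIV_mult[OF GDERIV_diff[OF GDERIV_\<gamma> GDERIV_const]
        GDERIV_diff[OF GDERIV_const GDERIV_\<rho>]]]) simp

lemmas gradient_area = gradient_eqI[OF GDERIV_area]

lemma continuous_on_gradient_area: "continuous_on UNIV (gradient A)"
  unfolding gradient_area using C1_\<gamma> C1_\<rho>
  by (intro continuous_intros) (auto simp: C1_def)

lemma convex_feasible: "convex X"
proof -
  have "X = unit_simplex \<inter> ({x. \<gamma>ref \<le> \<gamma> x} \<inter> {x. \<rho> x \<le> \<rho>ref})"
    by (auto simp: feasible_def)
  moreover have "convex {x. \<gamma>ref \<le> \<gamma> x}"
  proof (rule convexI)
    fix x y and u v :: real
    assume *: "x \<in> {x. \<gamma>ref \<le> \<gamma> x}" "y \<in> {x. \<gamma>ref \<le> \<gamma> x}" "0 \<le> u" "0 \<le> v" "u + v = 1"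
    then have "u * \<gamma>ref + v * \<gamma>ref \<le> u * \<gamma> x + v * \<gamma> y"
      by (intro add_mono mult_left_mono) auto
    also have "\<dots> \<le> \<gamma> (u *\<^sub>R x + v *\<^sub>R y)"
      using concave * by (auto simp: concave_on_iff)
    finally show "u *\<^sub>R x + v *\<^sub>R y \<in> {x. \<gamma>ref \<le> \<gamma> x}"
      using * by (simp flip: distrib_right)
  qed
  moreover have "convex {x. \<rho> x \<le> \<rho>ref}"
  proof (rule convexI)
    fix x y and u v :: real
    assume *: "x \<in> {x. \<rho> x \<le> \<rho>ref}" "y \<in> {x. \<rho> x \<le> \<rho>ref}" "0 \<le> u" "0 \<le> v" "u + v = 1"
    then have "\<rho> (u *\<^sub>R x + v *\<^sub>R y) \<le> u * \<rho> x + v * \<rho> y"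
      using convex by (auto simp: convex_on_def)
    also have "\<dots> \<le> u * \<rho>ref + v * \<rho>ref"
      using * by (intro add_mono mult_left_mono) auto
    finally show "u *\<^sub>R x + v *\<^sub>R y \<in> {x. \<rho> x \<le> \<rho>ref}"
      using * by (simp flip: distrib_right)
  qed
  ultimately show ?thesis
    by (simp add: convex_Int convex_unit_simplex)
qed

lemma compact_feasible: "compact X"
proof -
  have "closed {x. \<gamma>ref \<le> \<gamma> x \<and> \<rho> x \<le> \<rho>ref}"
    by (intro closed_Collect_conj closed_Collect_le continuous_intros)
  moreover have "X = unit_simplex \<inter> {x. \<gamma>ref \<le> \<gamma> x \<and> \<rho> x \<le> \<rho>ref}"
    by (auto simp: feasible_def)
  ultimately show ?thesis
    by (simp add: compact_Int_closed compact_unit_simplex)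
qed

lemma feasible_area_pos_iff: "x \<in> X \<Longrightarrow> 0 < A x \<longleftrightarrow> \<gamma>ref < \<gamma> x \<and> \<rho> x < \<rho>ref"
  by (auto simp: feasible_def area_def zero_less_mult_iff)

text \<open>The gradient of \<open>A\<close> is a sum of products, and each product contributes a Lipschitz constant
  of one factor times a bound of the other. Where the other factor is a gradient, it occurs only
  in the direction of the segment, where it is bounded by \<open>L\<gamma>\<close> or \<open>L\<rho>\<close>.\<close>

lemma area_gradient_variation:
  assumes lips: "Ld\<gamma>-lipschitz_on X (gradient \<gamma>)" "Ld\<rho>-lipschitz_on X (gradient \<rho>)"
      "L\<gamma>-lipschitz_on X \<gamma>" "L\<rho>-lipschitz_on X \<rho>"
    and L: "L = area_lipschitz Ld\<gamma> Ld\<rho> L\<gamma> L\<rho> \<gamma> \<rho> \<gamma>ref \<rho>ref"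
    and X: "x \<in> X" "x + d \<in> X" and t: "0 \<le> t" "t \<le> 1"
  shows "(gradient A (x + t *\<^sub>R d) - gradient A x) \<bullet> d \<ge> - L * t * (norm d)\<^sup>2"
proof -
  define u where "u = x + t *\<^sub>R d"
  have u: "u \<in> X"
    using convex_segment_point[OF convex_feasible X t] by (simp add: u_def)
  have dist_u: "norm (u - x) = t * norm d"
    using t by (simp add: u_def)
  have nonneg: "0 \<le> Ld\<gamma>" "0 \<le> Ld\<rho>" "0 \<le> L\<gamma>" "0 \<le> L\<rho>"
    using lips by (auto dest: lipschitz_on_nonneg)
  have "bdd_below (\<rho> ` X)" "bdd_above (\<gamma> ` X)"
    by (intro bounded_imp_bdd_below bounded_imp_bdd_above compact_imp_bounded
        compact_continuous_image compact_feasible continuous_intros)+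
  then have "(INF x\<in>X. \<rho> x) \<le> \<rho> u" "\<gamma> u \<le> (SUP x\<in>X. \<gamma> x)"
    using u by (auto intro: cINF_lower cSUP_upper)
  then have bounds: "\<bar>\<rho>ref - \<rho> u\<bar> \<le> \<rho>ref - (INF x\<in>X. \<rho> x)" "\<bar>\<gamma> u - \<gamma>ref\<bar> \<le> (SUP x\<in>X. \<gamma> x) - \<gamma>ref"
    using u by (auto simp: feasible_def)

  have grad: "\<bar>(gradient f u - gradient f x) \<bullet> d\<bar> \<le> (K * (t * norm d)) * norm d"
    if "K-lipschitz_on X (gradient f)" for f K
    using Cauchy_Schwarz_ineq2[of "gradient f u - gradient f x" d]
      lipschitz_on_normD[OF that u X(1)] mult_right_mono[OF _ norm_ge_zero]
    unfolding dist_u by (meson order_trans)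
  have dir: "\<bar>gradient \<gamma> x \<bullet> d\<bar> \<le> L\<gamma> * norm d" "\<bar>gradient \<rho> x \<bullet> d\<bar> \<le> L\<rho> * norm d"
    using lipschitz_on_imp_gradient_bound[OF lips(3) convex_feasible X GDERIV_\<gamma>]
      lipschitz_on_imp_gradient_bound[OF lips(4) convex_feasible X GDERIV_\<rho>] by simp_all
  have val: "\<bar>\<gamma> u - \<gamma> x\<bar> \<le> L\<gamma> * (t * norm d)" "\<bar>\<rho> x - \<rho> u\<bar> \<le> L\<rho> * (t * norm d)"
    using lipschitz_on_normD[OF lips(3) u X(1)] lipschitz_on_normD[OF lips(4) u X(1)]
    by (simp_all add: dist_u abs_minus_commute)
  have nn: "0 \<le> t * norm d" "0 \<le> norm d"
    using t by simp_all

  let ?p = "(\<rho>ref - \<rho> u) * ((gradient \<gamma> u - gradient \<gamma> x) \<bullet> d)"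
  let ?q = "(\<rho> x - \<rho> u) * (gradient \<gamma> x \<bullet> d)"
  let ?v = "(\<gamma> u - \<gamma>ref) * ((gradient \<rho> u - gradient \<rho> x) \<bullet> d)"
  let ?w = "(\<gamma> u - \<gamma> x) * (gradient \<rho> x \<bullet> d)"
  have "\<bar>?p\<bar> \<le> (\<rho>ref - (INF x\<in>X. \<rho> x)) * (Ld\<gamma> * (t * norm d) * norm d)"
    unfolding abs_mult using bounds by (intro mult_mono grad lips) auto
  moreover have "\<bar>?v\<bar> \<le> ((SUP x\<in>X. \<gamma> x) - \<gamma>ref) * (Ld\<rho> * (t * norm d) * norm d)"
    unfolding abs_mult using bounds by (intro mult_mono grad lips) auto
  moreover have "\<bar>?q\<bar> \<le> (L\<rho> * (t * norm d)) * (L\<gamma> * norm d)"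
    unfolding abs_mult using nonneg nn t by (intro mult_mono dir val mult_nonneg_nonneg) auto
  moreover have "\<bar>?w\<bar> \<le> (L\<gamma> * (t * norm d)) * (L\<rho> * norm d)"
    unfolding abs_mult using nonneg nn t by (intro mult_mono dir val mult_nonneg_nonneg) auto
  moreover have "(gradient A u - gradient A x) \<bullet> d = ?p + ?q - ?v - ?w"
    by (simp add: gradient_area inner_diff_left algebra_simps)
  moreover have "L * t * (norm d)\<^sup>2 =
      (\<rho>ref - (INF x\<in>X. \<rho> x)) * (Ld\<gamma> * (t * norm d) * norm d)
      + ((SUP x\<in>X. \<gamma> x) - \<gamma>ref) * (Ld\<rho> * (t * norm d) * norm d)
      + (L\<rho> * (t * norm d)) * (L\<gamma> * norm d) + (L\<gamma> * (t * norm d)) * (L\<rho> * norm d)"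
    by (simp add: L area_lipschitz_def algebra_simps power2_eq_square)
  ultimately show ?thesis
    unfolding u_def[symmetric] by linarith
qed

section \<open>Global optimality of stationary points\<close>

lemma stationary_imp_arg_max:
  assumes z: "z \<in> X" "0 < A z" and stat: "\<And>y. y \<in> X \<Longrightarrow> gradient A z \<bullet> (y - z) \<le> 0"
  shows "is_arg_max A (\<lambda>x. x \<in> X) z"
proof -
  have "A y \<le> A z" if y: "y \<in> X" for y
  proof -
    define gz rz gy ry where "gz = \<gamma> z - \<gamma>ref" and "rz = \<rho>ref - \<rho> z"
      and "gy = \<gamma> y - \<gamma>ref" and "ry = \<rho>ref - \<rho> y"
    note defs = gz_def rz_def gy_def ry_def
    have pos: "0 < gz" "0 < rz" "0 \<le> gy" "0 \<le> ry"
      using z y feasible_area_pos_iff[OF z(1)] by (auto simp: defs feasible_def)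
    have "gradient \<rho> z \<bullet> (y - z) \<le> \<rho> y - \<rho> z"
      using convex_on_gradient_inequality[OF convex _ _ GDERIV_\<rho>] by simp
    then have "gradient \<rho> z \<bullet> (y - z) \<le> rz - ry"
      by (simp add: defs)
    then have r: "gz * (gradient \<rho> z \<bullet> (y - z)) \<le> gz * (rz - ry)"
      using pos by (intro mult_left_mono) auto
    have "- gradient \<gamma> z \<bullet> (y - z) \<le> - \<gamma> y - - \<gamma> z"
      using concave by (intro convex_on_gradient_inequality[where S = UNIV] GDERIV_minus GDERIV_\<gamma>)
        (auto simp: concave_on_def)
    then have "gy - gz \<le> gradient \<gamma> z \<bullet> (y - z)"
      by (simp add: defs)
    then have "rz * (gy - gz) \<le> rz * (gradient \<gamma> z \<bullet> (y - z))"
      using pos by (intro mult_left_mono) auto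
    with r stat[OF y] have le: "rz * gy + gz * ry \<le> 2 * (gz * rz)"
      by (simp add: gradient_area inner_diff_left algebra_simps flip: gz_def rz_def)
    \<comment> \<open>arithmetic and geometric mean of \<open>rz * gy\<close> and \<open>gz * ry\<close>, in squared form\<close>
    have "4 * ((gz * rz) * (gy * ry)) \<le> (rz * gy + gz * ry)\<^sup>2"
      using zero_le_power2[of "rz * gy - gz * ry"] by (simp add: power2_eq_square algebra_simps)
    also have "\<dots> \<le> (2 * (gz * rz))\<^sup>2"
      using le pos by (intro power_mono) auto
    also have "\<dots> = 4 * ((gz * rz) * (gz * rz))"
      by (simp add: power2_eq_square)
    finally have "gy * ry \<le> gz * rz"
      using pos by simp
    then show ?thesis by (simp add: area_def defs)
  qed
  with z show ?thesis
    by (auto simp: is_arg_max_def not_less)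
qed

lemma arg_max_imp_pareto_optimal:
  assumes max: "is_arg_max A (\<lambda>x. x \<in> X) z" and pos: "0 < A z"
  shows "pareto_optimal \<gamma> \<rho> unit_simplex z"
proof -
  have z: "z \<in> X" and max: "\<And>y. y \<in> X \<Longrightarrow> A y \<le> A z"
    using max by (auto simp: is_arg_max_def not_less)
  have ref: "\<gamma>ref < \<gamma> z" "\<rho> z < \<rho>ref"
    using feasible_area_pos_iff[OF z] pos by auto
  have False if x: "x \<in> unit_simplex" "\<gamma> z \<le> \<gamma> x" "\<rho> x \<le> \<rho> z"
    and strict: "\<gamma> z < \<gamma> x \<or> \<rho> x < \<rho> z" for x
  proof -
    have "x \<in> X"
      using x ref by (auto simp: feasible_def)
    moreover have "A z < A x"
      unfolding area_def using strict x ref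
      by (auto intro: mult_strict_mono' mult_less_le_imp_less mult_le_less_imp_less)
    ultimately show False
      using max[of x] by simp
  qed
  with z show ?thesis
    unfolding pareto_optimal_def feasible_def by blast
qed

section \<open>A projected gradient step\<close>

lemma projection_obtuse_angle:
  fixes x y v :: "real^'n"
  assumes "y \<in> unit_simplex" and p: "p = closest_point unit_simplex (x + \<tau> *\<^sub>R v)"
  shows "\<tau> * (v \<bullet> (y - p)) \<le> (p - x) \<bullet> (y - p)"
  using closest_point_dot[OF convex_unit_simplex compact_imp_closed[OF compact_unit_simplex]
      assms(1), of "x + \<tau> *\<^sub>R v", folded p]
  by (simp add: inner_diff_left inner_add_left)

text \<open>The hypothesis on \<open>d\<close> is the obtuse-angle inequality of the projection, applied to the
  point from which the step starts. Since \<open>s \<le> 1\<close>, the linear gain \<open>s * (norm d)\<^sup>2 / \<tau>\<close> is at least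
  \<open>s\<^sup>2 * (norm d)\<^sup>2 / \<tau>\<close> and so is comparable with the quadratic loss.\<close>

lemma area_ge_along_step:
  assumes lips: "Ld\<gamma>-lipschitz_on X (gradient \<gamma>)" "Ld\<rho>-lipschitz_on X (gradient \<rho>)"
      "L\<gamma>-lipschitz_on X \<gamma>" "L\<rho>-lipschitz_on X \<rho>"
    and L: "L = area_lipschitz Ld\<gamma> Ld\<rho> L\<gamma> L\<rho> \<gamma> \<rho> \<gamma>ref \<rho>ref"
    and \<tau>: "0 < \<tau>" and d: "(norm d)\<^sup>2 / \<tau> \<le> gradient A x \<bullet> d"
    and s: "0 \<le> s" "s \<le> 1" and X: "x \<in> X" "x + s *\<^sub>R d \<in> X"
  shows "A x + s\<^sup>2 * ((1 / \<tau> - L / 2) * (norm d)\<^sup>2) \<le> A (x + s *\<^sub>R d)"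
proof -
  have "A x + gradient A x \<bullet> (s *\<^sub>R d) - L / 2 * (norm (s *\<^sub>R d))\<^sup>2 \<le> A (x + s *\<^sub>R d)"
    using area_gradient_variation[OF lips L X]
    by (intro quadratic_lower_bound) (simp_all add: gradient_area GDERIV_area)
  moreover have "s\<^sup>2 * ((norm d)\<^sup>2 / \<tau>) \<le> s * (gradient A x \<bullet> d)"
  proof (rule mult_mono)
    show "s\<^sup>2 \<le> s" using s by (simp add: power2_eq_square mult_left_le)
  qed (use s d \<tau> in auto)
  ultimately show ?thesis
    by (simp add: power_mult_distrib algebra_simps)
qed

text \<open>The set of \<open>s \<in> [0, 1]\<close> for which \<open>x + s *\<^sub>R (p - x)\<close> lies in \<open>X\<close> is compact and contains 0.
  At its largest element \<open>s\<close> the area is still positive, so neither reference constraint is active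
  there; if \<open>s < 1\<close>, the segment could be followed a bit further within \<open>X\<close>.\<close>

lemma projected_step:
  assumes lips: "Ld\<gamma>-lipschitz_on X (gradient \<gamma>)" "Ld\<rho>-lipschitz_on X (gradient \<rho>)"
      "L\<gamma>-lipschitz_on X \<gamma>" "L\<rho>-lipschitz_on X \<rho>"
    and L: "L = area_lipschitz Ld\<gamma> Ld\<rho> L\<gamma> L\<rho> \<gamma> \<rho> \<gamma>ref \<rho>ref"
    and \<tau>: "0 < \<tau>" "\<tau> * L < 2" and x: "x \<in> X" "0 < A x"
    and p: "p = closest_point unit_simplex (x + \<tau> *\<^sub>R gradient A x)"
  shows "p \<in> X" and "A x + (1 / \<tau> - L / 2) * (norm (p - x))\<^sup>2 \<le> A p"
proof -
  define d where "d = p - x"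
  define c where "c = 1 / \<tau> - L / 2"
  have c: "0 < c"
    using \<tau> by (simp add: c_def field_simps)
  have x_simplex: "x \<in> unit_simplex"
    using x by (simp add: feasible_def)
  then have p_simplex: "p \<in> unit_simplex"
    unfolding p by (intro closest_point_in_set compact_imp_closed compact_unit_simplex) auto
  have "\<tau> * (gradient A x \<bullet> (x - p)) \<le> (p - x) \<bullet> (x - p)"
    by (rule projection_obtuse_angle[OF x_simplex p])
  then have "(norm d)\<^sup>2 \<le> \<tau> * (gradient A x \<bullet> d)"
    by (simp add: d_def power2_norm_eq_inner algebra_simps inner_commute)
  then have "(norm d)\<^sup>2 / \<tau> \<le> gradient A x \<bullet> d"
    using \<tau> by (simp add: divide_le_eq mult.commute)
  note increase = area_ge_along_step[OF lips L \<tau>(1) this _ _ x(1), folded c_def]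

  define S where "S = {0..1} \<inter> {s. x + s *\<^sub>R d \<in> X}"
  have "closed {s. x + s *\<^sub>R d \<in> X}"
    using compact_imp_closed[OF compact_feasible]
    by (rule closed_vimage[unfolded vimage_def]) (intro continuous_intros)
  then have "compact S"
    unfolding S_def by (intro compact_Int_closed compact_Icc)
  moreover have "0 \<in> S"
    using x by (simp add: S_def)
  ultimately obtain s where s: "s \<in> S" and greatest: "\<And>t. t \<in> S \<Longrightarrow> t \<le> s"
    using compact_attains_sup by (metis empty_iff)
  then have s01: "0 \<le> s" "s \<le> 1" and sX: "x + s *\<^sub>R d \<in> X"
    by (auto simp: S_def)
  have "0 < A (x + s *\<^sub>R d)"
  proof -
    have "0 \<le> s\<^sup>2 * (c * (norm d)\<^sup>2)" using c by simp
    with increase[OF s01 sX] x(2) show ?thesis by linarith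
  qed
  then have inactive: "\<gamma>ref < \<gamma> (x + s *\<^sub>R d)" "\<rho> (x + s *\<^sub>R d) < \<rho>ref"
    using feasible_area_pos_iff[OF sX] by auto
  have "s = 1"
  proof (rule ccontr)
    assume "s \<noteq> 1"
    have "open {t. \<gamma>ref < \<gamma> (x + t *\<^sub>R d) \<and> \<rho> (x + t *\<^sub>R d) < \<rho>ref}"
      by (intro open_Collect_conj open_Collect_less continuous_intros
          continuous_on_compose2[OF continuous_on_\<gamma>] continuous_on_compose2[OF continuous_on_\<rho>])
        auto
    with inactive obtain e where e: "0 < e"
      and ball: "\<And>t. dist t s < e \<Longrightarrow> \<gamma>ref < \<gamma> (x + t *\<^sub>R d) \<and> \<rho> (x + t *\<^sub>R d) < \<rho>ref"
      unfolding open_dist by blast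
    define t where "t = min 1 (s + e / 2)"
    have t: "s < t" "t \<le> 1" "dist t s < e"
      using e s01 \<open>s \<noteq> 1\<close> by (auto simp: t_def dist_real_def min_def)
    then have "x + t *\<^sub>R d \<in> unit_simplex"
      unfolding d_def using s01 x_simplex p_simplex
      by (intro convex_segment_point convex_unit_simplex) auto
    with ball[OF t(3)] have "t \<in> S"
      using t s01 by (auto simp: S_def feasible_def)
    with greatest[OF this] t show False by simp
  qed
  with sX show "p \<in> X" by (simp add: d_def)
  with increase[of 1] show "A x + (1 / \<tau> - L / 2) * (norm (p - x))\<^sup>2 \<le> A p"
    by (simp add: d_def c_def)
qed

section \<open>Convergence of the method\<close>

text \<open>The last inequality is the obtuse-angle property if a projection is taken; if the method has
  stopped, then \<open>x (Suc k) = x k\<close> and it says that \<open>x k\<close> is stationary. One passage to the limit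
  therefore handles finite termination as well.\<close>

lemma iterate_step:
  fixes \<tau> x0
  defines "x \<equiv> iterate A X \<tau> x0"
  assumes lips: "Ld\<gamma>-lipschitz_on X (gradient \<gamma>)" "Ld\<rho>-lipschitz_on X (gradient \<rho>)"
      "L\<gamma>-lipschitz_on X \<gamma>" "L\<rho>-lipschitz_on X \<rho>"
    and L: "L = area_lipschitz Ld\<gamma> Ld\<rho> L\<gamma> L\<rho> \<gamma> \<rho> \<gamma>ref \<rho>ref"
    and \<tau>: "0 < \<tau>" "\<tau> * L < 2" and xk: "x k \<in> X" "0 < A (x k)"
  shows "x (Suc k) \<in> X"
    and "A (x k) + (1 / \<tau> - L / 2) * (norm (x (Suc k) - x k))\<^sup>2 \<le> A (x (Suc k))"
    and "y \<in> X \<Longrightarrow>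
      \<tau> * (gradient A (x k) \<bullet> (y - x (Suc k))) \<le> (x (Suc k) - x k) \<bullet> (y - x (Suc k))"
proof -
  have "x (Suc k) \<in> X \<and>
    A (x k) + (1 / \<tau> - L / 2) * (norm (x (Suc k) - x k))\<^sup>2 \<le> A (x (Suc k)) \<and>
    (y \<in> X \<longrightarrow>
      \<tau> * (gradient A (x k) \<bullet> (y - x (Suc k))) \<le> (x (Suc k) - x k) \<bullet> (y - x (Suc k)))"
  proof (cases "stationary A X (x k)")
    case True
    then have "x (Suc k) = x k"
      by (simp add: x_def)
    with True xk \<tau> show ?thesis
      by (auto simp: stationary_def mult_le_0_iff)
  next
    case False
    then have p: "x (Suc k) = closest_point unit_simplex (x k + \<tau> *\<^sub>R gradient A (x k))"
      by (simp add: x_def Let_def)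
    show ?thesis
      using projected_step[OF lips L \<tau> xk p] projection_obtuse_angle[OF _ p]
      by (auto simp: feasible_def)
  qed
  then show "x (Suc k) \<in> X"
    and "A (x k) + (1 / \<tau> - L / 2) * (norm (x (Suc k) - x k))\<^sup>2 \<le> A (x (Suc k))"
    and "y \<in> X \<Longrightarrow>
      \<tau> * (gradient A (x k) \<bullet> (y - x (Suc k))) \<le> (x (Suc k) - x k) \<bullet> (y - x (Suc k))"
    by blast+
qed

end

text \<open>The values \<open>a k\<close> increase to a limit, so their increments vanish, and these bound the squared
  lengths of the steps.\<close>

lemma sufficient_increase_imp_steps_tendsto_0:
  fixes x :: "nat \<Rightarrow> 'a::real_normed_vector" and a :: "nat \<Rightarrow> real"
  assumes "0 < c" and step: "\<And>k. a k + c * (norm (x (Suc k) - x k))\<^sup>2 \<le> a (Suc k)"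
    and bdd: "\<And>k. a k \<le> B"
  shows "(\<lambda>k. x (Suc k) - x k) \<longlonglongrightarrow> 0"
proof -
  have "incseq a"
  proof (rule incseq_SucI)
    fix k
    have "0 \<le> c * (norm (x (Suc k) - x k))\<^sup>2"
      using \<open>0 < c\<close> by simp
    with step[of k] show "a k \<le> a (Suc k)" by linarith
  qed
  then obtain l where "a \<longlonglongrightarrow> l"
    using incseq_convergent bdd by metis
  then have "(\<lambda>k. (a (Suc k) - a k) / c) \<longlonglongrightarrow> (l - l) / c"
    by (intro tendsto_intros LIMSEQ_Suc) (use \<open>0 < c\<close> in auto)
  then have upper: "(\<lambda>k. (a (Suc k) - a k) / c) \<longlonglongrightarrow> 0"
    by simp
  have "(norm (x (Suc k) - x k))\<^sup>2 \<le> (a (Suc k) - a k) / c" for k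
    using step[of k] \<open>0 < c\<close> by (simp add: le_divide_eq mult.commute)
  then have "(\<lambda>k. (norm (x (Suc k) - x k))\<^sup>2) \<longlonglongrightarrow> 0"
    by (intro tendsto_sandwich[OF _ _ tendsto_const upper]) simp_all
  then have "(\<lambda>k. sqrt ((norm (x (Suc k) - x k))\<^sup>2)) \<longlonglongrightarrow> sqrt 0"
    by (rule tendsto_real_sqrt)
  then show ?thesis
    by (simp add: tendsto_norm_zero_iff)
qed

theorem proposition3p2:
  fixes \<gamma> \<rho> :: "real^'n \<Rightarrow> real"
    and \<gamma>ref \<rho>ref Ld\<gamma> Ld\<rho> L\<gamma> L\<rho> \<tau> :: real
    and x0 :: "real^'n"
  defines "X \<equiv> feasible \<gamma> \<rho> \<gamma>ref \<rho>ref"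
    and "A \<equiv> area \<gamma> \<rho> \<gamma>ref \<rho>ref"
    and "L \<equiv> area_lipschitz Ld\<gamma> Ld\<rho> L\<gamma> L\<rho> \<gamma> \<rho> \<gamma>ref \<rho>ref"
  assumes "concave_on UNIV \<gamma>" and "convex_on UNIV \<rho>"
    and "C1 \<gamma>" and "C1 \<rho>"
    and "\<exists>K. K-lipschitz_on UNIV (gradient \<gamma>)"
    and "\<exists>K. K-lipschitz_on UNIV (gradient \<rho>)"
    and "Ld\<gamma>-lipschitz_on X (gradient \<gamma>)" and "Ld\<rho>-lipschitz_on X (gradient \<rho>)"
    and "L\<gamma>-lipschitz_on X \<gamma>" and "L\<rho>-lipschitz_on X \<rho>"
    and "0 < \<tau>" and "\<tau> * L < 2"
    and "x0 \<in> X" and "A x0 > 0"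
  shows "(\<forall>k. iterate A X \<tau> x0 k \<in> X \<and> A (iterate A X \<tau> x0 k) > 0) \<and>
    (\<forall>z. limit_point (iterate A X \<tau> x0) z \<longrightarrow>
       is_arg_max A (\<lambda>x. x \<in> X) z \<and> pareto_optimal \<gamma> \<rho> unit_simplex z)"
proof -
  interpret C: concave_convex_criteria \<gamma> \<rho> \<gamma>ref \<rho>ref
    by unfold_locales fact+
  define x where "x = iterate A X \<tau> x0"
  define c where "c = 1 / \<tau> - L / 2"
  have c: "0 < c"
    using \<open>0 < \<tau>\<close> \<open>\<tau> * L < 2\<close> by (simp add: c_def field_simps)
  note step = C.iterate_step[OF assms(10-13)[unfolded X_def] L_def[THEN meta_eq_to_obj_eq]
      \<open>0 < \<tau>\<close> \<open>\<tau> * L < 2\<close>, where ?x0.0 = x0, folded X_def A_def, folded x_def c_def]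
  have invariant: "x k \<in> X \<and> A x0 \<le> A (x k)" for k
  proof (induction k)
    case 0
    show ?case using \<open>x0 \<in> X\<close> by (simp add: x_def)
  next
    case (Suc k)
    then have k: "x k \<in> X" "0 < A (x k)"
      using \<open>A x0 > 0\<close> by auto
    have "0 \<le> c * (norm (x (Suc k) - x k))\<^sup>2"
      using c by simp
    with step(1,2)[OF k] Suc show ?case by auto
  qed
  then have xX: "x k \<in> X" and pos: "0 < A (x k)" for k
    using \<open>A x0 > 0\<close> by (auto intro: less_le_trans)
  have continuous: "isCont A z" "isCont (gradient A) z" for z
    using C.continuous_on_area[of UNIV] C.continuous_on_gradient_area
    by (auto simp: continuous_on_eq_continuous_at A_def)
  have "bdd_above (A ` X)"
    unfolding A_def X_def
    by (intro bounded_imp_bdd_above compact_imp_bounded compact_continuous_image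
        C.continuous_on_area C.compact_feasible)
  then obtain B where "\<And>k. A (x k) \<le> B"
    using xX by (auto simp: bdd_above_def)
  then have steps: "(\<lambda>k. x (Suc k) - x k) \<longlonglongrightarrow> 0"
    using c step(2)[OF xX pos]
    by (intro sufficient_increase_imp_steps_tendsto_0[where a = "\<lambda>k. A (x k)"])

  have "is_arg_max A (\<lambda>x. x \<in> X) z \<and> pareto_optimal \<gamma> \<rho> unit_simplex z"
    if limit: "limit_point x z" for z
  proof -
    obtain r where r: "strict_mono r" and lim: "(\<lambda>k. x (r k)) \<longlonglongrightarrow> z"
      using limit by (auto simp: limit_point_def o_def)
    have steps_r: "(\<lambda>k. x (Suc (r k)) - x (r k)) \<longlonglongrightarrow> 0"
      using LIMSEQ_subseq_LIMSEQ[OF steps r] by (simp add: o_def)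
    then have lim': "(\<lambda>k. x (Suc (r k))) \<longlonglongrightarrow> z"
      using tendsto_add[OF steps_r lim] by simp
    have zX: "z \<in> X"
      using closed_sequentially[OF compact_imp_closed[OF C.compact_feasible, folded X_def] _ lim]
        xX by blast
    have "A x0 \<le> A z"
      using isCont_tendsto_compose[OF continuous(1) lim] invariant
      by (intro tendsto_lowerbound[where f = "\<lambda>k. A (x (r k))"]) (auto intro!: always_eventually)
    with \<open>A x0 > 0\<close> have Az: "0 < A z" by simp
    have "gradient A z \<bullet> (y - z) \<le> 0" if y: "y \<in> X" for y
    proof -
      have "(\<lambda>k. \<tau> * (gradient A (x (r k)) \<bullet> (y - x (Suc (r k)))))
          \<longlonglongrightarrow> \<tau> * (gradient A z \<bullet> (y - z))"
        by (intro tendsto_intros isCont_tendsto_compose[OF continuous(2)] lim lim')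
      moreover have "(\<lambda>k. (x (Suc (r k)) - x (r k)) \<bullet> (y - x (Suc (r k)))) \<longlonglongrightarrow> 0 \<bullet> (y - z)"
        by (intro tendsto_intros steps_r lim')
      ultimately have "\<tau> * (gradient A z \<bullet> (y - z)) \<le> 0 \<bullet> (y - z)"
        using step(3)[OF xX pos y] by (intro LIMSEQ_le) auto
      with \<open>0 < \<tau>\<close> show ?thesis by (simp add: mult_le_0_iff)
    qed
    with zX Az have "is_arg_max A (\<lambda>x. x \<in> X) z"
      unfolding A_def X_def by (intro C.stationary_imp_arg_max)
    with Az show ?thesis
      using C.arg_max_imp_pareto_optimal unfolding A_def X_def by blast
  qed
  with xX pos show ?thesis
    unfolding x_def by blast
qed

end
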